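(* Let $T$ be a regular tournament on $n\geq 9$ vertices. If $\pi_2(T)> (n-9)/12$, then $T$ is path extendable.
   Context: A tournament is regular if every vertex has out-degree equal to its in-degree. For distinct vertices $u,v$ of a tournament $T$, $p_2(u,v)$ denotes the number of directed paths of length $2$ (with $2$ arcs) from $u$ to $v$ in $T$, and $\pi_2(T)=\min\{p_2(u,v) : u,v\in V(T),\ u\neq v\}$. All paths are directed paths. A path $P$ that is not hamiltonian is called extendable if there is a path $P'$ with the same initial and the same terminal vertex as $P$ and $V(P')=V(P)\cup\{w\}$ for some vertex $w\in V(T)\setminus V(P)$. A digraph is path extendable if every nonhamiltonian path of length at least $1$ in it is extendable. *)

theory Defs
  imports Complex_Main "Graph_Theory.Graph_Theory"
begin

locale tournament = digraph +
  assumes exactly_one_arc: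
    "\<And>u v. \<lbrakk>u \<in> verts G; v \<in> verts G; u \<noteq> v\<rbrakk> \<Longrightarrow> (u \<rightarrow>\<^bsub>G\<^esub> v) \<noteq> (v \<rightarrow>\<^bsub>G\<^esub> u)"

definition regular_digraph :: "('a, 'b) pre_digraph \<Rightarrow> bool" where
  "regular_digraph G \<longleftrightarrow> (\<forall>v \<in> verts G. out_degree G v = in_degree G v)"

text \<open>
  Paths are vertex sequences (\<^const>\<open>vpath\<close>). A tournament has no parallel arcs, so a path is
  determined by its vertex sequence. The length \<^const>\<open>vwalk_length\<close> counts arcs.
\<close>

definition p2 :: "('a, 'b) pre_digraph \<Rightarrow> 'a \<Rightarrow> 'a \<Rightarrow> nat" where
  "p2 G u v = card {p. vpath p G \<and> vwalk_length p = 2 \<and> hd p = u \<and> last p = v}"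

definition pi2 :: "('a, 'b) pre_digraph \<Rightarrow> nat" where
  "pi2 G = Min {p2 G u v | u v. u \<in> verts G \<and> v \<in> verts G \<and> u \<noteq> v}"

definition hamiltonian_path :: "('a, 'b) pre_digraph \<Rightarrow> 'a vwalk \<Rightarrow> bool" where
  "hamiltonian_path G p \<longleftrightarrow> vpath p G \<and> set p = verts G"

definition extendable_path :: "('a, 'b) pre_digraph \<Rightarrow> 'a vwalk \<Rightarrow> bool" where
  "extendable_path G p \<longleftrightarrow>
     (\<exists>p'. vpath p' G \<and> hd p' = hd p \<and> last p' = last p \<and>
        (\<exists>w \<in> verts G - set p. set p' = set p \<union> {w}))"

definition path_extendable :: "('a, 'b) pre_digraph \<Rightarrow> bool" where
  "path_extendable G \<longleftrightarrow>
     (\<forall>p. vpath p G \<and> \<not> hamiltonian_path G p \<and> 1 \<le> vwalk_length p \<longrightarrow> extendable_path G p)"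

end

theory Submission
  imports Defs
begin

text \<open>
  Let \<open>x\<^sub>1, \<dots>, x\<^sub>m\<close> be a path that cannot be extended, in a regular tournament on \<open>2k + 1\<close>
  vertices in which every pair is joined by at least \<open>c\<close> paths of length 2. Since an outside vertex
  \<open>w\<close> fits nowhere between consecutive path vertices, it dominates an initial segment of the path
  and is dominated by the rest; let \<open>a(w)\<close> be the length of that segment. In particular
  2-paths from \<open>x\<^sub>i\<close> to a later \<open>x\<^sub>j\<close> never leave the path.

  If \<open>a(w) \<in> {0, 1, m-1, m}\<close> for all \<open>w\<close>, the tournament is close to a blow-up of a cyclic
  triangle whose three parts are the path, the vertices with \<open>a(w) \<le> 1\<close>, and those with
  \<open>a(w) \<ge> m-1\<close>. The out-neighbourhood of \<open>x\<^sub>2\<close> and the in-neighbourhood of \<open>x\<^sub>m\<^sub>-\<^sub>1\<close> on the path have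
  at least \<open>2c + 1\<close> vertices each, so \<open>m \<ge> 4c + 3\<close>, while counting arcs inside the two outer parts
  bounds \<open>m\<close> by about a third of the number of vertices. This is where \<open>(n - 9) / 12\<close> comes from.

  If \<open>2 \<le> a(w) \<le> m-2\<close> for some \<open>w\<close>, then \<open>x\<^sub>u \<rightarrow> x\<^sub>t\<^sub>+\<^sub>1\<close> and \<open>x\<^sub>t \<rightarrow> x\<^sub>v\<close> cannot both hold for
  \<open>u < a(w) < v - 1\<close>, since otherwise \<open>x\<^sub>1 \<dots> x\<^sub>u x\<^sub>t\<^sub>+\<^sub>1 \<dots> x\<^sub>v\<^sub>-\<^sub>1 w x\<^sub>u\<^sub>+\<^sub>1 \<dots> x\<^sub>t x\<^sub>v \<dots> x\<^sub>m\<close> extends the path. For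
  \<open>u = 1\<close>, \<open>v = m\<close> this forces \<open>0 < a(w') < m\<close> to hold for at most two vertices \<open>w'\<close>. If there are
  two, the out-neighbourhoods of \<open>x\<^sub>1\<close> and \<open>x\<^sub>2\<close> (or dually) nearly agree and there is no 2-path
  from \<open>x\<^sub>1\<close> to \<open>x\<^sub>2\<close>. If there is only one, the path and that vertex span a regular tournament,
  where a Hamiltonian path from \<open>x\<^sub>1\<close> to \<open>x\<^sub>m\<close> is found by rerouting.
\<close>

section \<open>Tournaments as relations\<close>

locale tournament_relation =
  fixes V :: "'a set" and E :: "'a \<Rightarrow> 'a \<Rightarrow> bool"
  assumes finite_V: "finite V"
    and E_in_V: "E u v \<Longrightarrow> u \<in> V \<and> v \<in> V"
    and E_asym: "E u v \<Longrightarrow> \<not> E v u"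
    and E_total: "u \<in> V \<Longrightarrow> v \<in> V \<Longrightarrow> u \<noteq> v \<Longrightarrow> E u v \<or> E v u"
begin

lemma E_irrefl [simp]: "\<not> E v v"
  using E_asym by blast

lemma not_E_iff: "u \<in> V \<Longrightarrow> v \<in> V \<Longrightarrow> u \<noteq> v \<Longrightarrow> \<not> E u v \<longleftrightarrow> E v u"
  using E_asym E_total by blast

lemma converse: "tournament_relation V (\<lambda>u v. E v u)"
proof
  show "finite V" by (rule finite_V)
qed (use E_in_V E_asym E_total in blast)+

lemma restrict: "S \<subseteq> V \<Longrightarrow> tournament_relation S (\<lambda>u v. u \<in> S \<and> v \<in> S \<and> E u v)"
proof
  fix u v assume "S \<subseteq> V" "u \<in> S" "v \<in> S" "u \<noteq> v"
  then show "(u \<in> S \<and> v \<in> S \<and> E u v) \<or> (v \<in> S \<and> u \<in> S \<and> E v u)" using E_total by blast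
next
  show "finite S" if "S \<subseteq> V" using that finite_V by (rule finite_subset)
qed (use E_asym in simp_all)

text \<open>Each pair of \<open>S\<close> carries exactly one arc; the factor 2 avoids halving in
  the natural numbers.\<close>

lemma sum_in_degree:
  assumes "S \<subseteq> V"
  shows "2 * (\<Sum>v\<in>S. card {u \<in> S. E u v}) = card S * (card S - 1)"
proof -
  have fS: "finite S" using assms finite_V finite_subset by blast
  then show ?thesis using assms
  proof (induction S rule: finite_induct)
    case (insert a S)
    have fin: "finite S" by fact
    have a: "a \<in> V" "a \<notin> S" "S \<subseteq> V" using insert by auto
    have "card {u \<in> insert a S. E u v} = card {u \<in> S. E u v} + (if E a v then 1 else 0)" for v
    proof -
      have "{u \<in> insert a S. E u v} = (if E a v then insert a {u \<in> S. E u v} else {u \<in> S. E u v})"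
        by auto
      then show ?thesis using fin a by auto
    qed
    then have "(\<Sum>v\<in>insert a S. card {u \<in> insert a S. E u v})
       = card {u \<in> S. E u a} + ((\<Sum>v\<in>S. card {u \<in> S. E u v}) + (\<Sum>v\<in>S. if E a v then 1 else 0))"
      using fin a by (simp add: sum.distrib)
    also have "(\<Sum>v\<in>S. if E a v then 1 else 0) = card {v \<in> S. E a v}"
      using fin by (simp add: sum.If_cases Int_def)
    finally have eq: "(\<Sum>v\<in>insert a S. card {u \<in> insert a S. E u v})
       = card {u \<in> S. E u a} + card {v \<in> S. E a v} + (\<Sum>v\<in>S. card {u \<in> S. E u v})" by simp
    have "card {u \<in> S. E u a} + card {v \<in> S. E a v} = card ({u \<in> S. E u a} \<union> {v \<in> S. E a v})"
      using fin E_asym by (intro card_Un_disjoint [symmetric]) auto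
    also have "{u \<in> S. E u a} \<union> {v \<in> S. E a v} = S"
      using a E_total by blast
    finally have "2 * (\<Sum>v\<in>insert a S. card {u \<in> insert a S. E u v}) = 2 * card S + card S * (card S - 1)"
      using eq insert.IH a by simp
    also have "\<dots> = card (insert a S) * (card (insert a S) - 1)"
      using fin a by (cases "card S") auto
    finally show ?case .
  qed auto
qed

lemma sum_out_degree:
  assumes "S \<subseteq> V"
  shows "2 * (\<Sum>v\<in>S. card {u \<in> S. E v u}) = card S * (card S - 1)"
  using tournament_relation.sum_in_degree [OF converse assms] .

text \<open>The average in-degree inside \<open>S\<close> is \<open>(card S - 1) / 2\<close>, and
  the minimum cannot exceed the average.\<close>

lemma card_ge_of_min_in_degree:
  assumes "S \<subseteq> V" "S \<noteq> {}" "\<And>v. v \<in> S \<Longrightarrow> c \<le> card {u \<in> S. E u v}"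
  shows "2 * c + 1 \<le> card S"
proof -
  have fS: "finite S" using assms finite_V finite_subset by blast
  have "card S * c \<le> (\<Sum>v\<in>S. card {u \<in> S. E u v})"
    using sum_mono [of S "\<lambda>_. c" "\<lambda>v. card {u \<in> S. E u v}"] assms(3) by simp
  then have "2 * (card S * c) \<le> card S * (card S - 1)"
    unfolding sum_in_degree [OF assms(1), symmetric] by simp
  then have "card S * (2 * c) \<le> card S * (card S - 1)" by (simp only: mult.left_commute)
  moreover have "card S > 0" using fS assms(2) by (simp add: card_gt_0_iff)
  ultimately show ?thesis by simp
qed

end

section \<open>Auxiliary facts on index ranges\<close>

lemma successively_map_upt:
  assumes "\<And>i. a \<le> i \<Longrightarrow> Suc i < b \<Longrightarrow> R (f i) (f (Suc i))"
  shows "successively R (map f [a..<b])"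
  using assms
proof (induction b)
  case (Suc b)
  show ?case
  proof (cases "a < b")
    case True
    then show ?thesis using Suc.IH Suc.prems [of "b - 1"] Suc.prems
      by (auto simp: successively_append_iff last_map)
  qed auto
qed auto

text \<open>Shifted down by one, the indices satisfying \<open>f\<close> avoid those satisfying
  \<open>g\<close>; together with the indices missed by both they fill \<open>{c..d}\<close>. This
  turns a ban on crossings into an exact equation for degrees.\<close>

lemma card_shift_disjoint:
  fixes f g :: "nat \<Rightarrow> bool"
  assumes "\<And>t. c \<le> t \<Longrightarrow> t \<le> d \<Longrightarrow> \<not> (f (Suc t) \<and> g t)"
  shows "card {j \<in> {Suc c..Suc d}. f j} + card {j \<in> {c..d}. g j}
    + card {t \<in> {c..d}. \<not> f (Suc t) \<and> \<not> g t} = Suc d - c"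
proof -
  have "{j \<in> {Suc c..Suc d}. f j} = Suc ` {t \<in> {c..d}. f (Suc t)}"
  proof (intro equalityI subsetI)
    fix j assume "j \<in> {j \<in> {Suc c..Suc d}. f j}"
    then show "j \<in> Suc ` {t \<in> {c..d}. f (Suc t)}" by (cases j) auto
  qed auto
  then have "card {j \<in> {Suc c..Suc d}. f j} = card {t \<in> {c..d}. f (Suc t)}"
    by (simp add: card_image)
  moreover have "card {t \<in> {c..d}. f (Suc t)} + card {j \<in> {c..d}. g j}
      = card ({t \<in> {c..d}. f (Suc t)} \<union> {j \<in> {c..d}. g j})"
    using assms by (intro card_Un_disjoint [symmetric]) auto
  moreover have "card ({t \<in> {c..d}. f (Suc t)} \<union> {j \<in> {c..d}. g j})
      + card {t \<in> {c..d}. \<not> f (Suc t) \<and> \<not> g t} = card {c..d}"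
  proof -
    have "{t \<in> {c..d}. f (Suc t)} \<union> {j \<in> {c..d}. g j} \<union> {t \<in> {c..d}. \<not> f (Suc t) \<and> \<not> g t} = {c..d}"
      by auto
    then show ?thesis by (subst card_Un_disjoint [symmetric]) auto
  qed
  ultimately show ?thesis unfolding card_atLeastAtMost by linarith
qed

section \<open>Paths without extension\<close>

text \<open>The path \<open>x 1, \<dots>, x m\<close> is indexed from 1; values of \<open>x\<close> outside \<open>{1..m}\<close> are irrelevant.\<close>

locale stuck_path = tournament_relation +
  fixes x :: "nat \<Rightarrow> 'a" and m :: nat
  assumes m_ge_2: "2 \<le> m"
    and x_inj: "inj_on x {0<..m}"
    and x_in_V: "x ` {0<..m} \<subseteq> V"
    and x_arc: "\<And>i. 0 < i \<Longrightarrow> i < m \<Longrightarrow> E (x i) (x (Suc i))"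
    and stuck: "\<And>w q. w \<in> V - x ` {0<..m} \<Longrightarrow> distinct q \<Longrightarrow> successively E q \<Longrightarrow>
      set q = insert w (x ` {0<..m}) \<Longrightarrow> hd q = x 1 \<Longrightarrow> last q = x m \<Longrightarrow> False"
begin

abbreviation "P \<equiv> x ` {0<..m}"
abbreviation "W \<equiv> V - P"

lemma finite_W [simp]: "finite W" and finite_P [simp]: "finite P"
  using finite_V by auto

lemma x_mem [simp]: "0 < i \<Longrightarrow> i \<le> m \<Longrightarrow> x i \<in> V" "0 < i \<Longrightarrow> i \<le> m \<Longrightarrow> x i \<in> P"
  using x_in_V by auto

lemma x_eq_iff: "0 < i \<Longrightarrow> i \<le> m \<Longrightarrow> 0 < j \<Longrightarrow> j \<le> m \<Longrightarrow> x i = x j \<longleftrightarrow> i = j"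
  using inj_on_eq_iff [OF x_inj, of i j] by simp

lemma not_E_W_iff:
  assumes "w \<in> W" "0 < i" "i \<le> m"
  shows "\<not> E w (x i) \<longleftrightarrow> E (x i) w"
  using assms not_E_iff [of w "x i"] x_mem [of i] by blast

lemma card_P [simp]: "card P = m"
  by (simp add: card_image [OF x_inj])

lemma card_W: "card W + m = card V"
  using card_Diff_subset [of P V] card_mono [OF finite_V x_in_V] x_in_V by simp

lemma reversal_image: "(\<lambda>i. x (m + 1 - i)) ` {0<..m} = P"
proof (intro equalityI subsetI)
  fix y assume "y \<in> P"
  then obtain i where "y = x i" "0 < i" "i \<le> m" by auto
  then have "y = x (m + 1 - (m + 1 - i))" "m + 1 - i \<in> {0<..m}" by auto
  then show "y \<in> (\<lambda>i. x (m + 1 - i)) ` {0<..m}" by blast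
qed auto

text \<open>Source of all duality: a second interpretation of the locale turns facts about
  \<open>x 1\<close> and \<open>x 2\<close> into facts about \<open>x m\<close> and
  \<open>x (m - 1)\<close>.\<close>

lemma reversal: "stuck_path V (\<lambda>u v. E v u) (\<lambda>i. x (m + 1 - i)) m"
proof -
  note img = reversal_image
  interpret R: tournament_relation V "\<lambda>u v. E v u" by (rule converse)
  show ?thesis
  proof
    show "inj_on (\<lambda>i. x (m + 1 - i)) {0<..m}"
      using x_eq_iff by (auto intro!: inj_onI)
    show "E (x (m + 1 - Suc i)) (x (m + 1 - i))" if "0 < i" "i < m" for i
      using x_arc [of "m - i"] that by (simp add: Suc_diff_le)
    show False if q: "w \<in> V - (\<lambda>i. x (m + 1 - i)) ` {0<..m}" "distinct q"
      "successively (\<lambda>u v. E v u) q" "set q = insert w ((\<lambda>i. x (m + 1 - i)) ` {0<..m})"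
      "hd q = x (m + 1 - 1)" "last q = x (m + 1 - m)" for w q
    proof -
      have "q \<noteq> []" using q(4) by auto
      then show False
        using q stuck [of w "rev q"] unfolding img by (simp add: hd_rev last_rev)
    qed
  qed (use img m_ge_2 x_in_V in auto)
qed

lemma successively_x: "0 < a \<Longrightarrow> b \<le> Suc m \<Longrightarrow> successively E (map x [a..<b])"
  using x_arc by (intro successively_map_upt) auto

lemma no_insertion:
  assumes w: "w \<in> W" and i: "0 < i" "i < m" and wi: "E w (x (Suc i))"
  shows "E w (x i)"
proof (rule ccontr)
  assume "\<not> E w (x i)"
  then have iw: "E (x i) w" using w i not_E_W_iff by auto
  define q where "q = map x [1..<Suc i] @ w # map x [Suc i..<Suc m]"
  have "{0<..m} = {1..<Suc i} \<union> {Suc i..<Suc m}" using i by auto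
  then have st: "set q = insert w P" unfolding q_def by auto
  \<comment> \<open>A list of length \<open>m + 1\<close> covering \<open>m + 1\<close> vertices
    repeats none, so the segments need not be compared.\<close>
  have "length q = Suc m" using i unfolding q_def by simp
  then have d: "distinct q" using st w by (intro card_distinct) simp
  have "successively E q" using i iw wi successively_x unfolding q_def
    by (auto simp: successively_append_iff successively_Cons hd_map last_map simp del: upt_Suc)
  moreover have "hd q = x 1" "last q = x m"
    using i unfolding q_def by (auto simp: hd_append hd_map last_map simp del: upt_Suc)
  ultimately show False using stuck w d st by blast
qed

text \<open>This is \<open>a(w)\<close> of the introduction. As a cardinality it is a degree into
  the path by definition, and the length of the initial segment by
  \<open>no_insertion\<close>.\<close>

definition "cutoff w = card {i \<in> {0<..m}. E w (x i)}"

lemma cutoff_le_m: "cutoff w \<le> m"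
proof -
  have "cutoff w \<le> card {0<..m}" unfolding cutoff_def by (intro card_mono) auto
  then show ?thesis by simp
qed

text \<open>By \<open>no_insertion\<close> the indices dominated by \<open>w\<close> are downward
  closed, so their number determines them.\<close>

lemma E_W_iff:
  assumes "w \<in> W" "0 < i" "i \<le> m"
  shows "E w (x i) \<longleftrightarrow> i \<le> cutoff w"
proof -
  define J where "J = {i \<in> {0<..m}. E w (x i)}"
  have fJ: "finite J" unfolding J_def by simp
  have down: "j \<in> J" if "i \<in> J" "0 < j" "j \<le> i" for i j
    using that(3,2,1)
  proof (induction rule: inc_induct)
    case (step j)
    then show ?case using no_insertion [OF assms(1), of j] that(1) unfolding J_def by auto
  qed simp
  have "J = {0<..card J}"
  proof (cases "J = {}")
    case False
    have "j \<in> J \<longleftrightarrow> j \<in> {0<..Max J}" for j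
    proof
      assume "j \<in> J"
      then show "j \<in> {0<..Max J}" using Max_ge [OF fJ] by (simp add: J_def)
    qed (use down [OF Max_in [OF fJ False]] in simp)
    then have "J = {0<..Max J}" by blast
    then show ?thesis by (metis card_greaterThanAtMost diff_zero)
  qed auto
  then have "i \<in> J \<longleftrightarrow> i \<le> cutoff w" using assms unfolding cutoff_def J_def by (metis (no_types, lifting) greaterThanAtMost_iff)
  then show ?thesis using assms unfolding J_def by auto
qed

lemma E_to_W_iff:
  assumes "w \<in> W" "0 < i" "i \<le> m"
  shows "E (x i) w \<longleftrightarrow> cutoff w < i"
  using not_E_W_iff [OF assms] E_W_iff [OF assms] by auto

lemma no_crossing:
  assumes w: "w \<in> W" and u: "0 < u" "u < cutoff w" and v: "cutoff w + 2 \<le> v" "v \<le> m"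
    and t: "u < t" "Suc t < v" and us: "E (x u) (x (Suc t))" and tv: "E (x t) (x v)"
  shows False
proof -
  define q where "q = map x [1..<Suc u] @ map x [Suc t..<v] @ w # map x [Suc u..<Suc t] @ map x [v..<Suc m]"
  \<comment> \<open>The position of \<open>u\<close> and \<open>v\<close> around
    \<open>cutoff w\<close> is what lets \<open>w\<close> join \<open>x (v - 1)\<close> to
    \<open>x (Suc u)\<close>.\<close>
  have ww: "E (x (v - 1)) w" "E w (x (Suc u))"
    using w u v t by (auto simp: E_to_W_iff E_W_iff)
  have "{0<..m} = {1..<Suc u} \<union> {Suc t..<v} \<union> {Suc u..<Suc t} \<union> {v..<Suc m}"
    using u v t by auto
  then have st: "set q = insert w P" unfolding q_def by auto
  have "length q = Suc m" using u v t unfolding q_def by simp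
  then have d: "distinct q" using st w by (intro card_distinct) simp
  have "successively E q" using u v t us tv ww successively_x unfolding q_def
    by (auto simp: successively_append_iff successively_Cons hd_append hd_map last_map simp del: upt_Suc)
  moreover have "hd q = x 1" "last q = x m"
    using u v t unfolding q_def by (auto simp: hd_append hd_map last_map simp del: upt_Suc)
  ultimately show False using stuck w d st by blast
qed

text \<open>By \<open>no_crossing\<close> each slot \<open>t\<close> in \<open>{u+1..v-2}\<close>
  admits at most one of the two chords, so the three sets tally every slot exactly once.\<close>

lemma crossing_count:
  assumes "w \<in> W" "0 < u" "u < cutoff w" "cutoff w + 2 \<le> v" "v \<le> m"
  shows "card {j \<in> {u+2..v-1}. E (x u) (x j)} + card {j \<in> {u+1..v-2}. E (x j) (x v)}
    + card {t \<in> {u+1..v-2}. \<not> E (x u) (x (Suc t)) \<and> \<not> E (x t) (x v)} = v - 2 - u"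
proof -
  have "Suc (v - 2) = v - 1" using assms by simp
  then show ?thesis
    using card_shift_disjoint [of "u+1" "v-2" "\<lambda>j. E (x u) (x j)" "\<lambda>j. E (x j) (x v)"]
      no_crossing [OF assms] assms by force
qed

end

section \<open>Splitting degrees along the path\<close>

lemma card_filter_insert:
  "finite S \<Longrightarrow> j \<notin> S \<Longrightarrow> card {i \<in> insert j S. f i} = card {i \<in> S. f i} + of_bool (f j)"
proof -
  assume "finite S" "j \<notin> S"
  moreover have "{i \<in> insert j S. f i} = (if f j then insert j {i \<in> S. f i} else {i \<in> S. f i})" by auto
  ultimately show ?thesis by auto
qed

context stuck_path
begin

lemma card_out_split:
  "card {u \<in> V. E v u} = card {j \<in> {0<..m}. E v (x j)} + card {w \<in> W. E v w}"
proof -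
  have "{u \<in> V. E v u} = x ` {j \<in> {0<..m}. E v (x j)} \<union> {w \<in> W. E v w}"
    using x_in_V by auto
  then have "card {u \<in> V. E v u} = card (x ` {j \<in> {0<..m}. E v (x j)}) + card {w \<in> W. E v w}"
    by (simp only:) (intro card_Un_disjoint, auto simp: finite_V)
  moreover have "inj_on x {j \<in> {0<..m}. E v (x j)}"
    by (rule inj_on_subset [OF x_inj]) auto
  ultimately show ?thesis by (simp add: card_image)
qed

lemma card_in_split:
  "card {u \<in> V. E u v} = card {j \<in> {0<..m}. E (x j) v} + card {w \<in> W. E w v}"
proof -
  have "{u \<in> V. E u v} = x ` {j \<in> {0<..m}. E (x j) v} \<union> {w \<in> W. E w v}"
    using x_in_V by auto
  then have "card {u \<in> V. E u v} = card (x ` {j \<in> {0<..m}. E (x j) v}) + card {w \<in> W. E w v}"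
    by (simp only:) (intro card_Un_disjoint, auto simp: finite_V)
  moreover have "inj_on x {j \<in> {0<..m}. E (x j) v}"
    by (rule inj_on_subset [OF x_inj]) auto
  ultimately show ?thesis by (simp add: card_image)
qed

text \<open>Splits off the indices outside the range that \<open>crossing_count\<close> uses for
  \<open>u = 1\<close> and \<open>v = m\<close>; the next lemmas do the same for \<open>x 2\<close>
  and \<open>x m\<close>.\<close>

lemma card_out_first:
  assumes "4 \<le> m"
  shows "card {j \<in> {0<..m}. E (x 1) (x j)}
    = card {j \<in> {3..m-1}. E (x 1) (x j)} + 1 + of_bool (E (x 1) (x m))"
proof -
  have "E (x 1) (x 2)" using x_arc [of 1] assms by (simp add: numeral_2_eq_2)
  moreover have "{0<..m} = insert 1 (insert 2 (insert m {3..m-1}))" using assms by auto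
  ultimately show ?thesis using assms 
    by (simp only:, (subst card_filter_insert, (auto; fail), (auto; fail))+, simp)
qed

lemma card_out_second:
  assumes "4 \<le> m"
  shows "card {j \<in> {0<..m}. E (x 2) (x j)}
    = card {j \<in> {4..m-1}. E (x 2) (x j)} + 1 + of_bool (E (x 2) (x m))"
proof -
  have "E (x 1) (x 2)" "E (x 2) (x 3)"
    using x_arc [of 1] x_arc [of 2] assms by (simp_all add: numeral_2_eq_2 numeral_3_eq_3)
  moreover have "\<not> E (x 2) (x 1)" using calculation E_asym by blast
  moreover have "{0<..m} = insert 1 (insert 2 (insert 3 (insert m {4..m-1})))" using assms by auto
  ultimately show ?thesis using assms 
    by (simp only:, (subst card_filter_insert, (auto; fail), (auto; fail))+, simp)
qed

lemma card_in_last: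
  assumes "4 \<le> m"
  shows "card {j \<in> {0<..m}. E (x j) (x m)}
    = card {j \<in> {2..m-2}. E (x j) (x m)} + 1 + of_bool (E (x 1) (x m))"
proof -
  have "E (x (m-1)) (x m)" using x_arc [of "m-1"] assms by simp
  moreover have "{0<..m} = insert 1 (insert m (insert (m-1) {2..m-2}))" using assms by auto
  ultimately show ?thesis using assms 
    by (simp only:, (subst card_filter_insert, (auto; fail), (auto; fail))+, simp)
qed

lemma card_in_last':
  assumes "4 \<le> m"
  shows "card {j \<in> {2..m-2}. E (x j) (x m)}
    = card {j \<in> {3..m-2}. E (x j) (x m)} + of_bool (E (x 2) (x m))"
proof -
  have "{2..m-2} = insert 2 {3..m-2}" using assms by auto
  then show ?thesis using assms 
    by (simp only:, (subst card_filter_insert, (auto; fail), (auto; fail))+, simp)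
qed

end

section \<open>Regular tournaments with one vertex off the path\<close>

text \<open>With a single vertex outside, an extension is a Hamiltonian path from \<open>x 1\<close>
  to \<open>x m\<close>. Being stuck then depends on the two ends only, so another path with the
  same ends and length may replace \<open>x\<close>.\<close>

locale balanced_stuck_path = stuck_path +
  fixes a :: nat
  assumes m_eq: "m = 2 * a"
    and a_ge_3: "3 \<le> a"
    and card_V: "card V = Suc m"
    and out_degree: "\<And>v. v \<in> V \<Longrightarrow> card {u \<in> V. E v u} = a"
    and in_degree: "\<And>v. v \<in> V \<Longrightarrow> card {u \<in> V. E u v} = a"
begin

lemma balanced_reversal: "balanced_stuck_path V (\<lambda>u v. E v u) (\<lambda>i. x (m + 1 - i)) m a"
proof -
  interpret R: stuck_path V "\<lambda>u v. E v u" "\<lambda>i. x (m + 1 - i)" m by (rule reversal)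
  show ?thesis
    by unfold_locales (use m_eq a_ge_3 card_V out_degree in_degree in auto)
qed

lemma cutoff_eq: "w \<in> W \<Longrightarrow> cutoff w = a"
proof -
  assume w: "w \<in> W"
  have "card W = 1" using card_W card_V by simp
  then have "W = {w}" using w by (metis card_1_singletonE singletonD)
  then have "{u \<in> W. E w u} = {}" by auto
  then have "card {u \<in> W. E w u} = 0" by (simp only: card.empty)
  then show ?thesis using card_out_split [of w] out_degree [of w] w unfolding cutoff_def by simp
qed

lemma obtain_w: obtains w where "W = {w}" "w \<in> W"
proof -
  have "card W = 1" using card_W card_V by simp
  then show ?thesis using that by (metis card_1_singletonE singletonI)
qed

lemma out_degree_x:
  assumes "0 < i" "i \<le> a"
  shows "card {j \<in> {0<..m}. E (x i) (x j)} = a"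
proof -
  have "{w \<in> W. E (x i) w} = {}" using assms E_to_W_iff cutoff_eq m_eq by auto
  then have "card {w \<in> W. E (x i) w} = 0" by (simp only: card.empty)
  then show ?thesis using card_out_split [of "x i"] out_degree [of "x i"] assms m_eq by simp
qed

lemma in_degree_x:
  assumes "a < i" "i \<le> m"
  shows "card {j \<in> {0<..m}. E (x j) (x i)} = a"
proof -
  have "{w \<in> W. E w (x i)} = {}" using assms E_W_iff cutoff_eq m_eq by auto
  then have "card {w \<in> W. E w (x i)} = 0" by (simp only: card.empty)
  then show ?thesis using card_in_split [of "x i"] in_degree [of "x i"] assms m_eq by simp
qed

text \<open>Put \<open>e = of_bool (E (x 1) (x m))\<close>. Each end has \<open>a - 1 - e\<close>
  chords in the range of \<open>crossing_count\<close>, which leaves \<open>2 * e - 1\<close> free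
  slots; hence \<open>e = 1\<close>.\<close>

lemma first_last:
  shows E_first_last: "E (x 1) (x m)"
    and free_slots: "card {t \<in> {2..m-2}. \<not> E (x 1) (x (Suc t)) \<and> \<not> E (x t) (x m)} = 1"
proof -
  obtain w where w: "w \<in> W" using obtain_w by blast
  have c: "card {j \<in> {3..m-1}. E (x 1) (x j)} + card {j \<in> {2..m-2}. E (x j) (x m)}
    + card {t \<in> {2..m-2}. \<not> E (x 1) (x (Suc t)) \<and> \<not> E (x t) (x m)} = m - 3"
    using crossing_count [OF w, of 1 m] cutoff_eq [OF w] a_ge_3 m_eq
    by (simp add: numeral_2_eq_2 numeral_3_eq_3)
  have d: "card {j \<in> {3..m-1}. E (x 1) (x j)} + 1 + of_bool (E (x 1) (x m)) = a"
    "card {j \<in> {2..m-2}. E (x j) (x m)} + 1 + of_bool (E (x 1) (x m)) = a"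
    using card_out_first card_in_last out_degree_x [of 1] in_degree_x [of m] a_ge_3 m_eq by simp_all
  show "E (x 1) (x m)"
  proof (rule ccontr)
    assume "\<not> E (x 1) (x m)"
    then show False using c d m_eq a_ge_3 by simp
  qed
  then show "card {t \<in> {2..m-2}. \<not> E (x 1) (x (Suc t)) \<and> \<not> E (x t) (x m)} = 1"
    using c d m_eq a_ge_3 by simp
qed

text \<open>Otherwise the slots for \<open>u = 2\<close> and \<open>v = m\<close> would have to hold
  \<open>(a - 1) + (a - 2)\<close> chords, one more than the \<open>m - 4\<close> available.\<close>

lemma E_second_last: "E (x 2) (x m)"
proof (rule ccontr)
  assume n: "\<not> E (x 2) (x m)"
  obtain w where w: "w \<in> W" using obtain_w by blast
  have c: "card {j \<in> {4..m-1}. E (x 2) (x j)} + card {j \<in> {3..m-2}. E (x j) (x m)} \<le> m - 4"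
    using crossing_count [OF w, of 2 m] cutoff_eq [OF w] a_ge_3 m_eq by simp
  have d: "card {j \<in> {4..m-1}. E (x 2) (x j)} + 1 = a"
    "card {j \<in> {3..m-2}. E (x j) (x m)} + 2 = a"
    using card_out_second card_in_last card_in_last' out_degree_x [of 2] in_degree_x [of m]
      a_ge_3 m_eq n E_first_last by simp_all
  then show False using c m_eq a_ge_3 by simp
qed

text \<open>
  The detour \<open>x 1, x s, \<dots>, x (m-1), w, x 2, \<dots>, x (s-2), x m\<close> omits only \<open>x (s-1)\<close>,
  and everything known about the original path applies to it.
\<close>

lemma detour:
  assumes s: "4 \<le> s" "s < m" and E1s: "E (x 1) (x s)" and Esm: "E (x (s - 2)) (x m)"
  shows "E (x s) (x m)" and "s + 2 \<le> m \<Longrightarrow> E (x (s - 1)) (x (Suc s))"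
proof -
  obtain w where w: "W = {w}" "w \<in> W" using obtain_w by blast
  \<comment> \<open>\<open>x s\<close> to \<open>x (m - 1)\<close> take positions \<open>2\<close>
    to \<open>m - s + 1\<close>, then comes \<open>w\<close>, and \<open>x 2\<close> to
    \<open>x (s - 2)\<close> start at position \<open>m - s + 3\<close>.\<close>
  define y where "y i = (if i = 1 then x 1 else if i \<le> m - s + 1 then x (s + i - 2)
    else if i = m - s + 2 then w else if i < m then x (i + s - m - 1) else x m)" for i
  have V: "V = insert w P" using w x_in_V by blast
  have wx: "w \<noteq> x (s - 1)" using w(2) s x_mem(2) [of "s - 1"] by auto
  have "y ` {0<..m} = V - {x (s - 1)}"
  proof (intro equalityI subsetI)
    fix v assume "v \<in> y ` {0<..m}"
    then obtain i where i: "0 < i" "i \<le> m" "v = y i" by auto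
    then show "v \<in> V - {x (s - 1)}"
      using s w wx x_eq_iff [of _ "s - 1"] unfolding y_def by (auto split: if_splits)
  next
    fix v assume v: "v \<in> V - {x (s - 1)}"
    show "v \<in> y ` {0<..m}"
    proof (cases "v = w")
      case True
      then have "v = y (m - s + 2)" unfolding y_def using s by simp
      then show ?thesis using s by (intro image_eqI) auto
    next
      case False
      then obtain j where j: "0 < j" "j \<le> m" "v = x j" using v V by auto
      then have "j \<noteq> s - 1" using v by auto
      then consider "j = 1" | "j = m" | "s \<le> j" "j < m" | "2 \<le> j" "j \<le> s - 2"
        using j by linarith
      then show ?thesis
      proof cases
        case 1
        then have "v = y 1" unfolding y_def j by simp
        then show ?thesis using s by (intro image_eqI) auto
      next
        case 2
        then have "v = y m" unfolding y_def j using s by auto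
        then show ?thesis using s by (intro image_eqI) auto
      next
        case 3
        then have "v = y (j + 2 - s)" unfolding y_def j using s by auto
        then show ?thesis using s 3 by (intro image_eqI) auto
      next
        case 4
        then have "v = y (j + m + 1 - s)" unfolding y_def j using s by auto
        then show ?thesis using s 4 by (intro image_eqI) auto
      qed
    qed
  qed
  note img = this
  have xs: "x (s - 1) \<in> V" using s by simp
  interpret Q: balanced_stuck_path V E y m a
  proof
    show "inj_on y {0<..m}"
      using img xs card_V finite_V by (intro eq_card_imp_inj_on) auto
    show "E (y i) (y (Suc i))" if i: "0 < i" "i < m" for i
    proof -
      have ww: "E (x (m - 1)) w" "E w (x 2)"
        using w(2) cutoff_eq [of w] m_eq a_ge_3 by (auto simp: E_to_W_iff E_W_iff)
      consider "i = 1" | "1 < i" "i \<le> m - s" | "i = m - s + 1" | "i = m - s + 2" "s > 4" | "i = m - s + 2" "s = 4"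
        | "m - s + 2 < i" "Suc i < m" | "m - s + 2 < i" "Suc i = m"
        using i s by linarith
      then show ?thesis
      proof cases
        case 1 then show ?thesis unfolding y_def using s E1s by auto
      next
        case 2
        then have "Suc (s + i - 2) = s + Suc i - 2" "s + i - 2 < m" "0 < s + i - 2" using s by auto
        then show ?thesis using x_arc [of "s + i - 2"] 2 s unfolding y_def by auto
      next
        case 3 then show ?thesis unfolding y_def using s ww by auto
      next
        case 4 then show ?thesis unfolding y_def using s ww by (auto simp: numeral_2_eq_2)
      next
        case 5 then show ?thesis unfolding y_def using s ww by (auto simp: numeral_2_eq_2)
      next
        case 6
        then have "Suc (i + s - m - 1) = Suc i + s - m - 1" "i + s - m - 1 < m" "0 < i + s - m - 1"
          using s by auto
        then show ?thesis using x_arc [of "i + s - m - 1"] 6 s unfolding y_def by auto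
      next
        case 7
        then have "i + s - m - 1 = s - 2" by linarith
        then show ?thesis unfolding y_def using 7 s Esm by auto
      qed
    qed
    have yy: "y 1 = x 1" "y m = x m" unfolding y_def using s by auto
    show False if q: "z \<in> V - y ` {0<..m}" "distinct q" "successively E q"
       "set q = insert z (y ` {0<..m})" "hd q = y 1" "last q = y m" for z q
    proof -
      \<comment> \<open>An extension of \<open>y\<close> is a Hamiltonian path with the ends of
        \<open>x\<close>, hence also an extension of \<open>x\<close>.\<close>
      have "set q = V" using q(1,4) img xs by auto
      then show False using stuck [OF w(2) q(2,3)] q(5,6) V yy by simp
    qed
  qed (use img m_eq a_ge_3 card_V out_degree in_degree in auto)
  have "y 2 = x s" "y m = x m" unfolding y_def using s by auto
  then show "E (x s) (x m)" using Q.E_second_last by simp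
  assume "s + 2 \<le> m"
  then have "y 3 = x (Suc s)" unfolding y_def using s by auto
  \<comment> \<open>The omitted vertex is the outside vertex of \<open>y\<close>; its cutoff is
    \<open>a\<close>, at least 3, so it dominates \<open>y 3\<close>.\<close>
  moreover have "x (s - 1) \<in> Q.W" using img xs by auto
  ultimately show "E (x (s - 1)) (x (Suc s))"
    using Q.E_W_iff [of "x (s - 1)" 3] Q.cutoff_eq [of "x (s - 1)"] a_ge_3 m_eq by simp
qed

text \<open>
  Call \<open>t\<close> a free slot if neither \<open>x 1 \<rightarrow> x (t+1)\<close> nor \<open>x t \<rightarrow> x m\<close>. There is exactly one, so
  up to reversal it is not below \<open>a\<close>.
\<close>

lemma prefix_to_last:
  assumes nofree: "\<And>t. 2 \<le> t \<Longrightarrow> t < a \<Longrightarrow> E (x 1) (x (Suc t)) \<or> E (x t) (x m)"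
    and t: "2 \<le> t" "t < a"
  shows "E (x t) (x m)"
  using t
proof (induction t rule: dec_induct)
  case base
  show ?case by (rule E_second_last)
next
  case (step t)
  show ?case
  proof (rule ccontr)
    assume "\<not> E (x (Suc t)) (x m)"
    \<comment> \<open>The detour with \<open>s = t + 2\<close> now supplies both arcs of a crossing
      at slot \<open>t + 2\<close> for the pair \<open>Suc t\<close>, \<open>m\<close>.\<close>
    then have "E (x 1) (x (t + 2))" using nofree [of "Suc t"] step by simp
    moreover have "4 \<le> t + 2" "t + 2 < m" "t + 2 + 2 \<le> m" "E (x (t + 2 - 2)) (x m)"
      using step m_eq by auto
    ultimately have "E (x (t + 2)) (x m)" "E (x (Suc t)) (x (Suc (t + 2)))"
      using detour [of "t + 2"] by simp_all
    moreover obtain w where "w \<in> W" using obtain_w by blast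
    ultimately show False
      using no_crossing [of w "Suc t" m "t + 2"] cutoff_eq [of w] step m_eq by simp
  qed
qed

text \<open>All vertices before \<open>x a\<close> dominate \<open>x m\<close>, so the first
  \<open>a\<close> vertices have no forward chords among them. Degree counts then force a crossing
  at slot \<open>a\<close> with \<open>u = 2\<close>.\<close>

lemma no_free_slot_left_False:
  assumes nofree: "\<And>t. 2 \<le> t \<Longrightarrow> t < a \<Longrightarrow> E (x 1) (x (Suc t)) \<or> E (x t) (x m)"
    and y: "E (x 1) y" "E y (x 2)"
  shows False
proof -
  obtain w where w: "W = {w}" "w \<in> W" using obtain_w by blast
  note cw = cutoff_eq [OF w(2)]
  note cross = no_crossing [OF w(2), unfolded cw]
  have toLast: "E (x t) (x m)" if "0 < t" "t < a" for t
    using prefix_to_last [OF nofree, of t] E_first_last that by (cases "t = 1") auto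
  have L: "\<not> E (x u) (x s)" if "0 < u" "u + 2 \<le> s" "s \<le> a" for u s
  proof -
    have "u < s - 1" "s - 1 < a" "0 < s - 1" "Suc (s - 1) = s" using that by auto
    then show ?thesis using cross [of u m "s - 1"] toLast [of "s - 1"] that m_eq by auto
  qed
  have not1: "\<not> E (x 1) (x (Suc a))"
  proof
    assume "E (x 1) (x (Suc a))"
    then have "E (x (Suc a)) (x m)"
      using detour(1) [of "Suc a"] toLast [of "a - 1"] m_eq a_ge_3 by (simp add: numeral_2_eq_2)
    moreover have "E (x (m - 1)) (x m)" using x_arc [of "m - 1"] m_ge_2 by simp
    \<comment> \<open>These are \<open>a + 1\<close> in-neighbours of \<open>x m\<close>, one too
      many.\<close>
    ultimately have "insert (m - 1) (insert (Suc a) {0<..<a}) \<subseteq> {j \<in> {0<..m}. E (x j) (x m)}"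
      using toLast m_eq a_ge_3 by auto
    from card_mono [OF _ this] have "card (insert (m - 1) (insert (Suc a) {0<..<a})) \<le> a"
      using in_degree_x [of m] m_eq a_ge_3 by simp
    moreover have "card (insert (m - 1) (insert (Suc a) {0<..<a})) = a + 1"
    proof -
      have "m - 1 \<noteq> Suc a" "\<not> m - 1 < a" using m_eq a_ge_3 by linarith+
      then show ?thesis using a_ge_3 by (simp add: card_insert_if)
    qed
    ultimately show False by simp
  qed
  \<comment> \<open>Otherwise \<open>x a\<close> could dominate only \<open>x (Suc a)\<close> and
    the \<open>a - 2\<close> vertices before \<open>x (a - 1)\<close>.\<close>
  have "\<exists>v\<ge>a+2. v \<le> m \<and> E (x a) (x v)"
  proof (rule ccontr)
    assume c: "\<not> (\<exists>v\<ge>a+2. v \<le> m \<and> E (x a) (x v))"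
    have "E (x (a - 1)) (x a)" using x_arc [of "a - 1"] a_ge_3 m_eq by simp
    then have na: "\<not> E (x a) (x (a - 1))" using E_asym by blast
    have "{j \<in> {0<..m}. E (x a) (x j)} \<subseteq> insert (Suc a) {0<..<a-1}"
    proof
      fix j assume j: "j \<in> {j \<in> {0<..m}. E (x a) (x j)}"
      then have "j \<noteq> a" "j \<noteq> a - 1" "j < a + 2" using na c by auto
      then show "j \<in> insert (Suc a) {0<..<a-1}" using j by auto
    qed
    from card_mono [OF _ this] show False using out_degree_x [of a] a_ge_3
      by (simp add: card_insert_if)
  qed
  then obtain v where v: "a + 2 \<le> v" "v \<le> m" "E (x a) (x v)" by blast
  have "y \<noteq> w" using E_asym [of w "x 1"] E_W_iff [OF w(2), of 1] cw y m_eq a_ge_3 by auto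
  then have "y \<in> P" using E_in_V [OF y(1)] w by blast
  then obtain c where c: "0 < c" "c \<le> m" "y = x c" by auto
  have c2: "a + 2 \<le> c"
  proof (rule ccontr)
    assume "\<not> a + 2 \<le> c"
    moreover have "c \<noteq> 1" "c \<noteq> 2" "c \<noteq> Suc a" using y c not1 by auto
    ultimately show False using L [of 1 c] c y by auto
  qed
  \<comment> \<open>Otherwise \<open>x 2\<close> could dominate only \<open>x 3\<close> and the
    \<open>a - 2\<close> vertices beyond \<open>x (Suc a)\<close> other than
    \<open>x c\<close>.\<close>
  have "E (x 2) (x (Suc a))"
  proof (rule ccontr)
    assume n: "\<not> E (x 2) (x (Suc a))"
    have n1: "\<not> E (x 2) (x 1)" using x_arc [of 1] E_asym m_ge_2 by (simp add: numeral_2_eq_2)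
    have nc: "\<not> E (x 2) (x c)" using E_asym y c by blast
    have "{j \<in> {0<..m}. E (x 2) (x j)} \<subseteq> insert 3 ({a+2..m} - {c})"
    proof
      fix j assume j: "j \<in> {j \<in> {0<..m}. E (x 2) (x j)}"
      then have "j \<noteq> 1" "j \<noteq> 2" "j \<noteq> Suc a" "j \<noteq> c" using n n1 nc by auto
      moreover have "\<not> (4 \<le> j \<and> j \<le> a)" using j L [of 2 j] by auto
      ultimately show "j \<in> insert 3 ({a+2..m} - {c})" using j by auto
    qed
    from card_mono [OF _ this] show False using out_degree_x [of 2] a_ge_3 m_eq c c2
      by (simp add: card_insert_if)
  qed
  then show False using cross [of 2 v a] v a_ge_3 by simp
qed

text \<open>Reversal moves slot \<open>t\<close> to \<open>m - t\<close>, so in one of the two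
  orientations the only free slot is not below \<open>a\<close>. Either orientation may occur, hence
  a 2-path at each end.\<close>

lemma two_paths_False:
  assumes "E (x 1) y" "E y (x 2)" and "E (x (m - 1)) z" "E z (x m)"
  shows False
proof -
  interpret R: balanced_stuck_path V "\<lambda>u v. E v u" "\<lambda>i. x (m + 1 - i)" m a
    by (rule balanced_reversal)
  define F where "F = {t \<in> {2..m-2}. \<not> E (x 1) (x (Suc t)) \<and> \<not> E (x t) (x m)}"
  have "card F = 1" using free_slots unfolding F_def .
  then obtain t0 where F: "F = {t0}" by (rule card_1_singletonE)
  show False
  proof (cases "a \<le> t0")
    case True
    have "E (x 1) (x (Suc t)) \<or> E (x t) (x m)" if "2 \<le> t" "t < a" for t
    proof -
      have "t \<notin> F" using F True that by auto
      then show ?thesis unfolding F_def using that m_eq by auto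
    qed
    then show False using no_free_slot_left_False assms by blast
  next
    case False
    have "E (x (m + 1 - Suc t)) (x (m + 1 - 1)) \<or> E (x (m + 1 - m)) (x (m + 1 - t))" if "2 \<le> t" "t < a" for t
    proof -
      have "m - t \<notin> F" using F False that m_eq by auto
      then show ?thesis unfolding F_def using that m_eq by (auto simp: Suc_diff_le)
    qed
    moreover have "E z (x (m + 1 - 1))" "E (x (m + 1 - 2)) z" using assms m_ge_2 by simp_all
    ultimately show False using R.no_free_slot_left_False by blast
  qed
qed

end

section \<open>Degrees into the path, and 2-paths that stay on it\<close>

context stuck_path
begin

lemma card_out_P: "card {j \<in> {0<..m}. E v (x j)} = card {u \<in> P. E v u}"
proof -
  have "{u \<in> P. E v u} = x ` {j \<in> {0<..m}. E v (x j)}" by auto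
  moreover have "inj_on x {j \<in> {0<..m}. E v (x j)}" by (rule inj_on_subset [OF x_inj]) auto
  ultimately show ?thesis by (simp add: card_image)
qed

lemma card_in_P: "card {j \<in> {0<..m}. E (x j) v} = card {u \<in> P. E u v}"
proof -
  have "{u \<in> P. E u v} = x ` {j \<in> {0<..m}. E (x j) v}" by auto
  moreover have "inj_on x {j \<in> {0<..m}. E (x j) v}" by (rule inj_on_subset [OF x_inj]) auto
  ultimately show ?thesis by (simp add: card_image)
qed

lemma card_to_W:
  assumes "w \<in> W"
  shows "card {u \<in> P. E u w} = m - cutoff w"
proof -
  have "{j \<in> {0<..m}. E (x j) w} = {cutoff w<..m}" using assms E_to_W_iff by auto
  then show ?thesis using card_in_P [of w] by simp
qed

lemma reversal_cutoff:
  assumes "w \<in> W"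
  shows "stuck_path.cutoff (\<lambda>u v. E v u) (\<lambda>i. x (m + 1 - i)) m w = m - cutoff w"
proof -
  interpret R: stuck_path V "\<lambda>u v. E v u" "\<lambda>i. x (m + 1 - i)" m by (rule reversal)
  have "R.cutoff w = card {u \<in> R.P. E u w}" unfolding R.cutoff_def by (rule R.card_out_P)
  then show ?thesis unfolding reversal_image using card_to_W [OF assms] by simp
qed

text \<open>An outside \<open>y\<close> dominated by \<open>x i\<close> has cutoff below
  \<open>i\<close> and cannot dominate a later vertex.\<close>

lemma two_path_in_P:
  assumes "0 < i" "i < j" "j \<le> m" "E (x i) y" "E y (x j)"
  shows "y \<in> P"
proof (rule ccontr)
  assume "y \<notin> P"
  then have "y \<in> W" using E_in_V [OF assms(4)] by blast
  then show False using assms E_to_W_iff [of y i] E_W_iff [of y j] by simp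
qed

end

text \<open>Here \<open>s\<close>, \<open>t\<close> count the outside vertices of low and high
  cutoff, and \<open>n\<close>, \<open>n'\<close> those of cutoff exactly \<open>1\<close> and
  \<open>m - 1\<close>. The quadratic bounds give \<open>3 * m <= 2 * k + 5\<close>, the first
  bounds give \<open>m >= 4 * c + 3\<close>. As \<open>k <= 6 * c + 3\<close>, this forces
  \<open>m = 4 * c + 3\<close> and \<open>s = t = k - 2 * c - 1\<close>; the refinements in
  \<open>key\<close> exclude \<open>k = 6 * c + 2\<close> and make the bound on \<open>n'\<close>
  tight for \<open>k = 6 * c + 3\<close>.\<close>

lemma extreme_arith:
  fixes s t n n' m k c :: nat
  assumes "s + t + m = 2 * k + 1" "0 < s + t" "0 < c" "k \<le> 6 * c + 3" "2 \<le> m"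
    and s: "s + (2 * c + 1) \<le> k" "n \<le> s" "n + k \<le> s + (m - 1)"
      "2 * (s * m) + s * (s - 1) \<le> 2 * (s * k) + 2 * n"
    and t: "t + (2 * c + 1) \<le> k" "n' \<le> t" "n' + k \<le> t + (m - 1)"
      "2 * (t * m) + t * (t - 1) \<le> 2 * (t * k) + 2 * n'"
  shows "n' + k = t + (m - 1) \<and> k = s + (2 * c + 1)"
proof -
  have key: "q = 0 \<or> 2 * m + q \<le> 2 * k + 3 \<and> (2 * m + q = 2 * k + 3 \<longrightarrow> q \<le> p) \<and> (2 * m + q = 2 * k + 2 \<longrightarrow> q \<le> 2 * p)"
    if "2 * (q * m) + q * (q - 1) \<le> 2 * (q * k) + 2 * p" "p \<le> q" for p q :: nat
  proof (cases q)
    case (Suc q')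
    have h: "q * (2 * m + q) \<le> q * (2 * k + 1) + 2 * p" using that Suc by (simp add: algebra_simps)
    have e3: "q * (2 * k + 3) = q * (2 * k + 1) + 2 * q" and e2: "q * (2 * k + 2) = q * (2 * k + 1) + q"
      by (simp_all add: algebra_simps)
    have "q * (2 * m + q) \<le> q * (2 * k + 3)" using h e3 that(2) by linarith
    then have "2 * m + q \<le> 2 * k + 3" using Suc by (simp only: mult_le_cancel1)
    moreover have "q \<le> p" if eq: "2 * m + q = 2 * k + 3" using h e3 unfolding eq by linarith
    moreover have "q \<le> 2 * p" if eq: "2 * m + q = 2 * k + 2" using h e2 unfolding eq by linarith
    ultimately show ?thesis by blast
  qed simp
  show ?thesis using key [OF s(4,2)] key [OF t(4,2)] assms(1-5) s(1-3) t(1-3) by linarith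
qed

section \<open>Regular tournaments with many 2-paths\<close>

text \<open>For \<open>n = 2 * k + 1\<close>, \<open>k_le\<close> is the integral form of
  \<open>c > (n - 9) / 12\<close>.\<close>

locale regular_stuck_path = stuck_path +
  fixes k c :: nat
  assumes card_V: "card V = 2 * k + 1"
    and W_nonempty: "W \<noteq> {}"
    and out_degree: "\<And>v. v \<in> V \<Longrightarrow> card {u \<in> V. E v u} = k"
    and in_degree: "\<And>v. v \<in> V \<Longrightarrow> card {u \<in> V. E u v} = k"
    and two_paths: "\<And>u v. u \<in> V \<Longrightarrow> v \<in> V \<Longrightarrow> u \<noteq> v \<Longrightarrow> c \<le> card {y \<in> V. E u y \<and> E y v}"
    and c_pos: "0 < c"
    and k_le: "k \<le> 6 * c + 3"
begin

lemma regular_reversal: "regular_stuck_path V (\<lambda>u v. E v u) (\<lambda>i. x (m + 1 - i)) m k c"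
proof -
  interpret R: stuck_path V "\<lambda>u v. E v u" "\<lambda>i. x (m + 1 - i)" m by (rule reversal)
  show ?thesis
  proof
    show "c \<le> card {y \<in> V. E y u \<and> E v y}" if "u \<in> V" "v \<in> V" "u \<noteq> v" for u v
      using two_paths [of v u] that by (simp add: conj_commute)
  qed (use card_V W_nonempty out_degree in_degree c_pos k_le reversal_image in auto)
qed

lemma card_W_eq: "card W + m = 2 * k + 1"
  using card_W card_V by simp

lemma exists_two_path:
  assumes "0 < i" "i < j" "j \<le> m"
  obtains l where "0 < l" "l \<le> m" "E (x i) (x l)" "E (x l) (x j)"
proof -
  have "{y \<in> V. E (x i) y \<and> E y (x j)} \<noteq> {}"
    using two_paths [of "x i" "x j"] x_eq_iff [of i j] assms c_pos by (intro notI) simp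
  then obtain y where y: "E (x i) y" "E y (x j)" by blast
  then have "y \<in> P" using two_path_in_P assms by blast
  then show ?thesis using that y by auto
qed

lemma out_P: "0 < i \<Longrightarrow> i \<le> m \<Longrightarrow> card {u \<in> P. E (x i) u} + card {w \<in> W. cutoff w < i} = k"
proof -
  assume i: "0 < i" "i \<le> m"
  then have "{w \<in> W. E (x i) w} = {w \<in> W. cutoff w < i}" using E_to_W_iff by blast
  then show ?thesis using card_out_split [of "x i"] out_degree [of "x i"] i card_out_P [of "x i"] by simp
qed

lemma in_P: "0 < i \<Longrightarrow> i \<le> m \<Longrightarrow> card {u \<in> P. E u (x i)} + card {w \<in> W. i \<le> cutoff w} = k"
proof -
  assume i: "0 < i" "i \<le> m"
  then have "{w \<in> W. E w (x i)} = {w \<in> W. i \<le> cutoff w}" using E_W_iff by blast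
  then show ?thesis using card_in_split [of "x i"] in_degree [of "x i"] i card_in_P [of "x i"] by simp
qed

text \<open>For \<open>i\<close> equal to 1 or 2 every out-neighbour of \<open>x i\<close> on the
  path comes later, so the 2-paths to it stay on the path and their midpoints are out-neighbours of
  \<open>x i\<close> as well.\<close>

lemma neighbourhood_in_degree:
  assumes i: "i = 1 \<or> i = 2" and v: "v \<in> P" "E (x i) v"
  shows "c \<le> card {u \<in> {u \<in> P. E (x i) u}. E u v}"
proof -
  obtain j where j: "0 < j" "j \<le> m" "v = x j" using v by auto
  have "j \<noteq> i" using v j by auto
  moreover have "\<not> (i = 2 \<and> j = 1)"
    using x_arc [of 1] E_asym v j m_ge_2 by (auto simp: numeral_2_eq_2)
  ultimately have ij: "0 < i" "i < j" using i j by auto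
  have "{y \<in> V. E (x i) y \<and> E y v} = {u \<in> {u \<in> P. E (x i) u}. E u v}"
    using two_path_in_P [of i j] ij j x_in_V by blast
  moreover have "c \<le> card {y \<in> V. E (x i) y \<and> E y v}"
    using two_paths [of "x i" v] ij j x_eq_iff [of i j] by simp
  ultimately show ?thesis by simp
qed

lemma out_P_ge:
  assumes i: "i = 1 \<or> i = 2" "i < m"
  shows "2 * c + 1 \<le> card {u \<in> P. E (x i) u}"
proof (rule card_ge_of_min_in_degree)
  have "x (Suc i) \<in> {u \<in> P. E (x i) u}" using x_arc [of i] i by auto
  then show "{u \<in> P. E (x i) u} \<noteq> {}" by blast
qed (use x_in_V neighbourhood_in_degree [OF i(1)] in auto)

lemma in_P_last_ge: "2 * c + 1 \<le> card {u \<in> P. E u (x m)}"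
proof -
  interpret R: regular_stuck_path V "\<lambda>u v. E v u" "\<lambda>i. x (m + 1 - i)" m k c by (rule regular_reversal)
  show ?thesis using R.out_P_ge [of 1] m_ge_2 unfolding reversal_image by simp
qed

lemma m_ge_4: "4 \<le> m"
proof -
  have "{u \<in> P. E (x 1) u} \<subseteq> P - {x 1}" by auto
  then have "card {u \<in> P. E (x 1) u} \<le> card (P - {x 1})" by (intro card_mono) auto
  also have "\<dots> = m - 1" using m_ge_2 by simp
  finally show ?thesis using out_P_ge [of 1] m_ge_2 c_pos by simp
qed

text \<open>Sums the out-degrees of the path vertices; arcs leaving the path are counted at their
  heads.\<close>

lemma degree_sum: "2 * (m * k) = m * (m - 1) + 2 * (\<Sum>w\<in>W. m - cutoff w)"
proof -
  have "m * k = (\<Sum>v\<in>P. card {u \<in> V. E v u})" 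
  proof -
    have "(\<Sum>v\<in>P. card {u \<in> V. E v u}) = (\<Sum>v\<in>P. k)"
      using out_degree x_in_V by (intro sum.cong) auto
    then show ?thesis by simp
  qed
  also have "\<dots> = (\<Sum>v\<in>P. card {u \<in> P. E v u}) + (\<Sum>v\<in>P. card {w \<in> W. E v w})"
    by (simp only: card_out_split card_out_P sum.distrib)
  also have "(\<Sum>v\<in>P. card {w \<in> W. E v w}) = (\<Sum>w\<in>W. card {v \<in> P. E v w})"
    by (rule sum_multicount_gen) auto
  also have "\<dots> = (\<Sum>w\<in>W. m - cutoff w)" using card_to_W by (intro sum.cong) auto
  finally show ?thesis using sum_out_degree [OF x_in_V] by simp
qed

section \<open>Outside vertices sorted by cutoff, and the case of a middle cutoff\<close>

definition "S0 = {w \<in> W. cutoff w = 0}"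
definition "Sm = {w \<in> W. cutoff w = m}"
definition "M = {w \<in> W. 0 < cutoff w \<and> cutoff w < m}"

lemma finite_parts [simp]: "finite S0" "finite Sm" "finite M"
  unfolding S0_def Sm_def M_def using finite_V by auto

lemma W_eq_parts: "W = S0 \<union> Sm \<union> M"
  using cutoff_le_m unfolding S0_def Sm_def M_def by (auto simp: order_le_less)

lemma parts_disjoint: "S0 \<inter> Sm = {}" "(S0 \<union> Sm) \<inter> M = {}"
  using m_ge_2 unfolding S0_def Sm_def M_def by auto

lemma card_parts: "card S0 + card Sm + card M = card W"
  using W_eq_parts parts_disjoint by (metis card_Un_disjoint finite_Un finite_parts)

lemma degree_sum_parts: "2 * (m * k) = m * (m - 1) + 2 * (m * card S0) + 2 * (\<Sum>w\<in>M. m - cutoff w)"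
proof -
  have "(\<Sum>w\<in>W. m - cutoff w) = (\<Sum>w\<in>S0. m - cutoff w) + (\<Sum>w\<in>Sm. m - cutoff w) + (\<Sum>w\<in>M. m - cutoff w)"
    
    unfolding W_eq_parts using parts_disjoint by (simp add: sum.union_disjoint)
  also have "(\<Sum>w\<in>S0. m - cutoff w) = m * card S0" unfolding S0_def by simp
  also have "(\<Sum>w\<in>Sm. m - cutoff w) = 0" unfolding Sm_def by simp
  finally show ?thesis using degree_sum by simp
qed

lemma out_first: "card {j \<in> {0<..m}. E (x 1) (x j)} + card S0 = k"
  using out_P [of 1] m_ge_2 unfolding S0_def card_out_P by simp

lemma in_last: "card {j \<in> {0<..m}. E (x j) (x m)} + card Sm = k"
proof -
  have "{w \<in> W. m \<le> cutoff w} = Sm" unfolding Sm_def using cutoff_le_m by (auto intro: antisym)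
  then show ?thesis using in_P [of m] m_ge_2 unfolding card_in_P by simp
qed

text \<open>The count of \<open>first_last\<close> with several outside vertices:
  \<open>card M\<close> plus the number of free slots is twice
  \<open>of_bool (E (x 1) (x m))\<close>, and \<open>w\<close> makes this positive.\<close>

lemma middle_count:
  assumes w: "w \<in> W" "2 \<le> cutoff w" "cutoff w + 2 \<le> m"
  shows "E (x 1) (x m)"
    and "card M + card {t \<in> {2..m-2}. \<not> E (x 1) (x (Suc t)) \<and> \<not> E (x t) (x m)} = 2"
proof -
  have c: "card {j \<in> {3..m-1}. E (x 1) (x j)} + card {j \<in> {2..m-2}. E (x j) (x m)}
    + card {t \<in> {2..m-2}. \<not> E (x 1) (x (Suc t)) \<and> \<not> E (x t) (x m)} = m - 3"
    using crossing_count [OF w(1), of 1 m] w by (simp add: numeral_2_eq_2 numeral_3_eq_3)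
  have eq: "card M + card {t \<in> {2..m-2}. \<not> E (x 1) (x (Suc t)) \<and> \<not> E (x t) (x m)}
    = 2 * of_bool (E (x 1) (x m))"
    using c card_out_first card_in_last out_first in_last card_parts card_W_eq m_ge_4 by linarith
  have "w \<in> M" using w unfolding M_def by simp
  then have "0 < card M" by (auto simp: card_gt_0_iff)
  then show e: "E (x 1) (x m)" using eq by (cases "E (x 1) (x m)") auto
  show "card M + card {t \<in> {2..m-2}. \<not> E (x 1) (x (Suc t)) \<and> \<not> E (x t) (x m)} = 2"
    using eq e by simp
qed

text \<open>No cutoff equals 1, so \<open>x 2\<close> has as many out-neighbours on the path as
  \<open>x 1\<close>, and the pair \<open>2\<close>, \<open>m\<close> has no free slot. For a
  midpoint \<open>x l\<close> of a 2-path from \<open>x 1\<close> to \<open>x 2\<close>, slot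
  \<open>l - 1\<close> then requires \<open>x 2\<close> to dominate \<open>x l\<close>.\<close>

lemma left_False:
  assumes w: "w \<in> W" "3 \<le> cutoff w" "cutoff w + 2 \<le> m"
    and M: "card M = 2" "\<And>w. w \<in> M \<Longrightarrow> 2 \<le> cutoff w"
  shows False
proof -
  have w2: "2 \<le> cutoff w" using w by simp
  note mc = middle_count [OF w(1) w2 w(3)]
  have "card {t \<in> {2..m-2}. \<not> E (x 1) (x (Suc t)) \<and> \<not> E (x t) (x m)} = 0" using mc M by simp
  then have f1: "E (x 1) (x (Suc t)) \<or> E (x t) (x m)" if "2 \<le> t" "t \<le> m - 2" for t
    using that by auto
  have "{w \<in> W. cutoff w < 2} = S0"
  proof
    show "{w \<in> W. cutoff w < 2} \<subseteq> S0"
    proof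
      fix v assume v: "v \<in> {w \<in> W. cutoff w < 2}"
      have "v \<notin> M" using M(2) [of v] v by auto
      then show "v \<in> S0" using v m_ge_4 unfolding M_def S0_def by auto
    qed
  qed (auto simp: S0_def)
  then have o2: "card {j \<in> {0<..m}. E (x 2) (x j)} + card S0 = k"
    using out_P [of 2] m_ge_2 unfolding card_out_P by simp
  have c: "card {j \<in> {4..m-1}. E (x 2) (x j)} + card {j \<in> {3..m-2}. E (x j) (x m)}
    + card {t \<in> {3..m-2}. \<not> E (x 2) (x (Suc t)) \<and> \<not> E (x t) (x m)} = m - 4"
    using crossing_count [OF w(1), of 2 m] w by simp
  have "card {t \<in> {3..m-2}. \<not> E (x 2) (x (Suc t)) \<and> \<not> E (x t) (x m)} + 2 = 2 * of_bool (E (x 2) (x m))"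
  proof -
    have "of_bool (E (x 1) (x m)) = (1 :: nat)" using mc(1) by simp
    then show ?thesis
      using c card_out_second card_in_last card_in_last' o2 in_last card_parts card_W_eq m_ge_4 M(1)
      by linarith
  qed
  then have e2: "E (x 2) (x m)" and
    "card {t \<in> {3..m-2}. \<not> E (x 2) (x (Suc t)) \<and> \<not> E (x t) (x m)} = 0"
    by (cases "E (x 2) (x m)"; simp)+
  then have f2: "E (x 2) (x (Suc t)) \<or> E (x t) (x m)" if "3 \<le> t" "t \<le> m - 2" for t
    using that by auto
  obtain l where l: "0 < l" "l \<le> m" "E (x 1) (x l)" "E (x l) (x 2)"
    using exists_two_path [of 1 2] m_ge_2 by auto
  have "l \<noteq> 1" "l \<noteq> 2" using l by auto
  moreover have "l \<noteq> 3" using l x_arc [of 2] m_ge_4 E_asym by (auto simp: numeral_2_eq_2 numeral_3_eq_3)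
  moreover have "l \<noteq> m" using l e2 E_asym by auto
  ultimately have l4: "3 \<le> l - 1" "l - 1 \<le> m - 2" "Suc (l - 1) = l" "l < m" "1 < l - 1"
    using l by auto
  have "\<not> E (x (l - 1)) (x m)"
    using no_crossing [OF w(1), of 1 m "l - 1"] w l l4 by auto
  then have "E (x 2) (x l)" using f2 l4 by metis
  then show False using l E_asym by blast
qed

lemma middle_False:
  assumes w: "w \<in> W" "2 \<le> cutoff w" "cutoff w + 2 \<le> m"
  shows False
proof -
  note mc = middle_count [OF w]
  have wM: "w \<in> M" using w unfolding M_def by simp
  then have "0 < card M" by (auto simp: card_gt_0_iff)
  then consider "card M = 1" | "card M = 2" using mc(2) by linarith
  then show False
  proof cases
    case 1
    then have M: "M = {w}" using wM by (metis card_1_singletonE singletonD)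
    let ?V = "insert w P"
    let ?E = "\<lambda>u v. u \<in> ?V \<and> v \<in> ?V \<and> E u v"
    have V': "?V \<subseteq> V" using w x_in_V by blast
    have dS: "2 * (m * k) = m * (m - 1) + 2 * (m * card S0) + 2 * (m - cutoff w)"
      using degree_sum_parts M by simp
    \<comment> \<open>Every path vertex dominates all of \<open>S0\<close>, so \<open>d\<close> is
      its out-degree within the path and \<open>w\<close>.\<close>
    define d where "d = k - card S0"
    have kd: "k = card S0 + d" using out_first unfolding d_def by simp
    have eq: "2 * (m * d) = m * (m - 1) + 2 * (m - cutoff w)"
    proof -
      have "m * k = m * card S0 + m * d" unfolding kd by (rule distrib_left)
      then show ?thesis using dS by linarith
    qed
    \<comment> \<open>As \<open>0 < m - cutoff w < m\<close>, divisibility leaves only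
      \<open>2 * (m - cutoff w) = m\<close>.\<close>
    then have "m dvd m * (m - 1) + 2 * (m - cutoff w)" by (metis dvd_triv_left mult.left_commute)
    then have "m dvd 2 * (m - cutoff w)" by (simp add: dvd_add_right_iff)
    then obtain q where q: "2 * (m - cutoff w) = m * q" by (rule dvdE)
    have "q \<noteq> 0" using q w by (intro notI) simp
    moreover have "q < 2"
    proof (rule ccontr)
      assume "\<not> q < 2"
      then have "m * 2 \<le> m * q" by simp
      then show False using q w by linarith
    qed
    ultimately have "q = 1" by linarith
    then have ma: "m = 2 * cutoff w" using q w by simp
    have "m * (2 * d) = m * m"
    proof -
      have "m * (2 * d) = m * (m - 1) + m" using eq ma by (simp add: algebra_simps)
      also have "\<dots> = m * m" using m_ge_2 by (simp add: algebra_simps)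
      finally show ?thesis .
    qed
    then have da: "d = cutoff w" using m_ge_2 ma by simp
    have Sm_card: "k = card Sm + d"
      using card_parts card_W_eq 1 kd da ma by simp
    have "2 * c + 1 \<le> d"
      using out_P_ge [of 1] m_ge_4 out_first kd card_out_P [of "x 1"] by simp
    then have a3: "3 \<le> cutoff w" using da c_pos by simp
    have part: "V = ?V \<union> S0 \<union> Sm" "?V \<inter> S0 = {}" "?V \<inter> Sm = {}"
    proof -
      have "w \<notin> S0" "w \<notin> Sm" using w unfolding S0_def Sm_def by simp_all
      moreover have "S0 \<inter> P = {}" "Sm \<inter> P = {}" unfolding S0_def Sm_def by blast+
      ultimately show "V = ?V \<union> S0 \<union> Sm" "?V \<inter> S0 = {}" "?V \<inter> Sm = {}"
        using W_eq_parts M x_in_V by blast+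
    qed
    have degx: "card {u \<in> ?V. E (x i) u} = d" "card {u \<in> ?V. E u (x i)} = d" if i: "0 < i" "i \<le> m" for i
    proof -
      have "{u \<in> V. E (x i) u} = {u \<in> ?V. E (x i) u} \<union> S0"
        using part(1) i E_to_W_iff [of _ i] m_ge_2 unfolding S0_def Sm_def by auto
      then have "card {u \<in> V. E (x i) u} = card {u \<in> ?V. E (x i) u} + card S0"
        using part(2) by (simp only:) (intro card_Un_disjoint, auto)
      then show "card {u \<in> ?V. E (x i) u} = d" using out_degree [of "x i"] i kd by simp
      have "{u \<in> V. E u (x i)} = {u \<in> ?V. E u (x i)} \<union> Sm"
        using part(1) i E_W_iff [of _ i] m_ge_2 unfolding S0_def Sm_def by auto
      then have "card {u \<in> V. E u (x i)} = card {u \<in> ?V. E u (x i)} + card Sm"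
        using part(3) by (simp only:) (intro card_Un_disjoint, auto)
      then show "card {u \<in> ?V. E u (x i)} = d" using in_degree [of "x i"] i Sm_card by simp
    qed
    have "{u \<in> ?V. E w u} = {u \<in> P. E w u}" "{u \<in> ?V. E u w} = {u \<in> P. E u w}" by auto
    then have degw: "card {u \<in> ?V. E w u} = d" "card {u \<in> ?V. E u w} = d"
      using card_out_P [of w] card_to_W [OF w(1)] da ma unfolding cutoff_def by simp_all
    have deg: "card {u \<in> ?V. E v u} = d" "card {u \<in> ?V. E u v} = d" if "v \<in> ?V" for v
      using that degx degw by auto
    interpret T: tournament_relation ?V ?E by (rule restrict [OF V'])
    interpret B: balanced_stuck_path ?V ?E x m "cutoff w"
    proof
      show "?E (x i) (x (Suc i))" if "0 < i" "i < m" for i using x_arc that by auto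
      show False if q: "z \<in> ?V - P" "distinct q" "successively ?E q" "set q = insert z P"
        "hd q = x 1" "last q = x m" for z q
      proof -
        have "successively E q" using q(3) by (rule successively_mono) simp
        then show False using stuck [of z q] q V' by auto
      qed
      show "card ?V = Suc m" using w by simp
      show "card {u \<in> ?V. ?E v u} = cutoff w" if "v \<in> ?V" for v
      proof -
        have "{u \<in> ?V. ?E v u} = {u \<in> ?V. E v u}" using that by auto
        then show ?thesis using deg(1) [OF that] da by (simp only:)
      qed
      show "card {u \<in> ?V. ?E u v} = cutoff w" if "v \<in> ?V" for v
      proof -
        have "{u \<in> ?V. ?E u v} = {u \<in> ?V. E u v}" using that by auto
        then show ?thesis using deg(2) [OF that] da by (simp only:)
      qed
    qed (use m_ge_2 x_inj a3 ma in auto)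
    obtain l where l: "0 < l" "l \<le> m" "E (x 1) (x l)" "E (x l) (x 2)"
      using exists_two_path [of 1 2] m_ge_2 by auto
    obtain l' where l': "0 < l'" "l' \<le> m" "E (x (m - 1)) (x l')" "E (x l') (x m)"
      using exists_two_path [of "m - 1" m] m_ge_2 by auto
    show False using B.two_paths_False [of "x l" "x l'"] l l' m_ge_2 by simp
  next
    case 2
    then obtain w' where M: "M = {w, w'}" "w \<noteq> w'"
      using wM by (metis card_2_iff doubleton_eq_iff insertE singletonD)
    have w': "w' \<in> W" "0 < cutoff w'" "cutoff w' < m" using M unfolding M_def by auto
    have m5: "5 \<le> m"
      using out_P_ge [of 1] in_P_last_ge out_first in_last card_out_P [of "x 1"] card_in_P [of "x m"]
        card_parts card_W_eq 2 c_pos m_ge_4 by simp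
    define r where "r = (m - cutoff w) + (m - cutoff w')"
    have "2 * (m * k) = m * (m - 1) + 2 * (m * card S0) + 2 * r"
      using degree_sum_parts M unfolding r_def by simp
    then have "m dvd m * (m - 1) + 2 * (m * card S0) + 2 * r" by (metis dvd_triv_left mult.left_commute)
    moreover have "m * (m - 1) + 2 * (m * card S0) + 2 * r = m * (m - 1 + 2 * card S0) + 2 * r"
      by (simp add: algebra_simps)
    ultimately have dv: "m dvd 2 * r" by (simp add: dvd_add_right_iff)
    have nr1: "r \<noteq> m + 1"
    proof
      assume "r = m + 1"
      then have "m dvd m * 2 + 2" using dv by (simp add: algebra_simps)
      then have "m dvd 2" by (metis dvd_add_right_iff dvd_triv_left)
      then show False using m5 by (auto dest: dvd_imp_le)
    qed
    have nr2: "r + 1 \<noteq> m"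
    proof
      assume "r + 1 = m"
      then have "2 * r + 2 = m * 2" by simp
      then have "m dvd 2" using dv by (metis dvd_add_right_iff dvd_triv_left)
      then show False using m5 by (auto dest: dvd_imp_le)
    qed
    interpret R: regular_stuck_path V "\<lambda>u v. E v u" "\<lambda>i. x (m + 1 - i)" m k c by (rule regular_reversal)
    have RM: "R.M = M"
      unfolding R.M_def M_def reversal_image
    proof (rule Collect_cong)
      fix v show "v \<in> W \<and> 0 < R.cutoff v \<and> R.cutoff v < m \<longleftrightarrow> v \<in> W \<and> 0 < cutoff v \<and> cutoff v < m"
        using reversal_cutoff [of v] cutoff_le_m [of v] m_ge_2 by (cases "v \<in> W") auto
    qed
    have right: False if "cutoff w + 3 \<le> m" "cutoff w' + 2 \<le> m"
    proof (rule R.left_False [of w])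
      show "w \<in> R.W" using w unfolding reversal_image by simp
      show "3 \<le> R.cutoff w" "R.cutoff w + 2 \<le> m" using reversal_cutoff [OF w(1)] w that by auto
      show "card R.M = 2" using 2 RM by simp
      show "2 \<le> R.cutoff v" if "v \<in> R.M" for v
        using that M w w' reversal_cutoff \<open>cutoff w' + 2 \<le> m\<close> unfolding RM by auto
    qed
    have left: False if "3 \<le> cutoff w" "2 \<le> cutoff w'"
      using left_False [OF w(1) that(1) w(3) 2] that(2) w M by auto
    have "\<not> (3 \<le> cutoff w \<and> 2 \<le> cutoff w')" using left by blast
    then have "cutoff w = 2 \<or> cutoff w' = 1" using w w' by auto
    moreover have "\<not> (cutoff w + 3 \<le> m \<and> cutoff w' + 2 \<le> m)" using right by blast
    then have "cutoff w + 2 = m \<or> cutoff w' + 1 = m" using w w' by auto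
    \<comment> \<open>The four surviving combinations give \<open>m = 4\<close>,
      \<open>m = 2\<close>, \<open>r + 1 = m\<close> or \<open>r = m + 1\<close>.\<close>
    ultimately show False using nr1 nr2 w w' m5 unfolding r_def by linarith
  qed
qed

text \<open>Input for \<open>extreme_arith\<close>, one side at a time. The vertex
  \<open>x 2\<close> dominates all \<open>s\<close> vertices, \<open>x 1\<close> only the
  \<open>s - n\<close> of cutoff 0, and this bounds their degrees on the path.\<close>

lemma low_counts:
  defines "s \<equiv> card {w \<in> W. cutoff w \<le> 1}" and "n \<equiv> card {w \<in> W. cutoff w = 1}"
  shows "s + (2 * c + 1) \<le> k"
    and "n \<le> s"
    and "n + k \<le> s + (m - 1)"
    and "n + k = s + (m - 1) \<Longrightarrow> v \<in> P \<Longrightarrow> v \<noteq> x 1 \<Longrightarrow> E (x 1) v"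
    and "2 * (s * m) + s * (s - 1) \<le> 2 * (s * k) + 2 * n"
proof -
  let ?S = "{w \<in> W. cutoff w \<le> 1}"
  have S2: "{w \<in> W. cutoff w < 2} = ?S" by auto
  show "s + (2 * c + 1) \<le> k"
    using out_P [of 2] out_P_ge [of 2] m_ge_4 unfolding S2 s_def by simp
  show "n \<le> s" unfolding n_def s_def using finite_V by (intro card_mono) auto
  have fin: "finite ?S" using finite_V by simp
  have "s = card (S0 \<union> {w \<in> W. cutoff w = 1})"
    unfolding s_def S0_def by (rule arg_cong [where f = card]) auto
  also have "\<dots> = card S0 + n" unfolding n_def S0_def using finite_V by (intro card_Un_disjoint) auto
  finally have sn: "s = card S0 + n" .
  have o1: "card {u \<in> P. E (x 1) u} + card S0 = k" using out_first card_out_P [of "x 1"] by simp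
  have sub: "{u \<in> P. E (x 1) u} \<subseteq> P - {x 1}" by auto
  have cP: "card (P - {x 1}) = m - 1" using m_ge_2 by simp
  have "card {u \<in> P. E (x 1) u} \<le> m - 1" using card_mono [OF _ sub] cP by simp
  then show "n + k \<le> s + (m - 1)" using sn o1 by linarith
  show "E (x 1) v" if "n + k = s + (m - 1)" "v \<in> P" "v \<noteq> x 1"
  proof -
    have "card {u \<in> P. E (x 1) u} = card (P - {x 1})" using sn o1 that cP by linarith
    then have "{u \<in> P. E (x 1) u} = P - {x 1}" using sub by (intro card_subset_eq) auto
    then show ?thesis using that by auto
  qed
  \<comment> \<open>The in-degree \<open>k\<close> of each \<open>w\<close> is at least its
    in-degree from the path plus that from \<open>?S\<close>.\<close>
  have "(\<Sum>w\<in>?S. m - cutoff w) + (\<Sum>w\<in>?S. card {u \<in> ?S. E u w}) \<le> (\<Sum>w\<in>?S. k)"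
    unfolding sum.distrib [symmetric]
  proof (rule sum_mono)
    fix w assume w: "w \<in> ?S"
    have "card {u \<in> ?S. E u w} \<le> card {u \<in> W. E u w}" using finite_V by (intro card_mono) auto
    moreover have "card {u \<in> P. E u w} + card {u \<in> W. E u w} = k"
      using card_in_split [of w] in_degree [of w] w card_in_P [of w] by simp
    ultimately show "(m - cutoff w) + card {u \<in> ?S. E u w} \<le> k" using card_to_W [of w] w by simp
  qed
  moreover have "2 * (\<Sum>w\<in>?S. card {u \<in> ?S. E u w}) = s * (s - 1)"
    unfolding s_def by (rule sum_in_degree) auto
  moreover have "(\<Sum>w\<in>?S. m - cutoff w) + n = s * m"
  proof -
    have "n = (\<Sum>w\<in>?S. cutoff w)"
    proof -
      have "(\<Sum>w\<in>?S. cutoff w) = (\<Sum>w\<in>?S. if cutoff w = 1 then 1 else 0)"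
        by (intro sum.cong) auto
      also have "\<dots> = card {w \<in> ?S. cutoff w = 1}" using fin by (simp add: sum.If_cases Int_def)
      also have "{w \<in> ?S. cutoff w = 1} = {w \<in> W. cutoff w = 1}" by auto
      finally show ?thesis unfolding n_def by simp
    qed
    then have "(\<Sum>w\<in>?S. m - cutoff w) + n = (\<Sum>w\<in>?S. (m - cutoff w) + cutoff w)"
      by (simp only: sum.distrib)
    also have "\<dots> = (\<Sum>w\<in>?S. m)" using cutoff_le_m by (intro sum.cong) auto
    finally show ?thesis unfolding s_def by simp
  qed
  moreover have "(\<Sum>w\<in>?S. k) = s * k" unfolding s_def by simp
  ultimately show "2 * (s * m) + s * (s - 1) \<le> 2 * (s * k) + 2 * n" by linarith
qed

text \<open>Tightness leaves exactly \<open>2 * c + 1\<close> out-neighbours of \<open>x 2\<close>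
  on the path. Minimum in-degree \<open>c\<close> would make the tournament on them regular, yet
  \<open>x m\<close> is among them and is dominated by all the others.\<close>

lemma extreme_False:
  assumes ext: "\<And>w. w \<in> W \<Longrightarrow> cutoff w \<le> 1 \<or> m \<le> cutoff w + 1"
  shows False
proof -
  interpret R: regular_stuck_path V "\<lambda>u v. E v u" "\<lambda>i. x (m + 1 - i)" m k c by (rule regular_reversal)
  let ?S = "{w \<in> W. cutoff w \<le> 1}" and ?T = "{w \<in> W. m \<le> cutoff w + 1}"
  have RW: "R.W = W" unfolding reversal_image ..
  have T: "{w \<in> R.W. R.cutoff w \<le> 1} = ?T"
    unfolding RW using reversal_cutoff by auto
  have "W = ?S \<union> ?T" using ext by blast
  moreover have "?S \<inter> ?T = {}" using m_ge_4 by auto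
  ultimately have "card W = card ?S + card ?T" using finite_V by (metis (no_types, lifting) card_Un_disjoint finite_Un finite_W)
  then have "card ?S + card ?T + m = 2 * k + 1" "0 < card ?S + card ?T"
    using card_W_eq W_nonempty card_gt_0_iff [of W] by simp_all
  from extreme_arith [OF this c_pos k_le m_ge_2 low_counts(1-3,5) R.low_counts(1-3,5) [unfolded T]]
  have tight: "card {w \<in> R.W. R.cutoff w = 1} + k = card ?T + (m - 1)" "k = card ?S + (2 * c + 1)"
    by auto
  have all_last: "E v (x m)" if "v \<in> P" "v \<noteq> x m" for v
    using R.low_counts(4) [unfolded T, OF tight(1), of v] that unfolding reversal_image by simp
  let ?N = "{u \<in> P. E (x 2) u}"
  have "{w \<in> W. cutoff w < 2} = ?S" by auto
  then have cN: "card ?N = 2 * c + 1" using out_P [of 2] tight(2) m_ge_4 by simp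
  have fN: "finite ?N" by simp
  have "x 2 \<noteq> x m" using x_eq_iff [of 2 m] m_ge_4 by simp
  then have xmN: "x m \<in> ?N" using all_last [of "x 2"] m_ge_4 by simp
  have "{u \<in> ?N. E u (x m)} = ?N - {x m}" using all_last by auto
  then have "card {u \<in> ?N. E u (x m)} = 2 * c" using cN xmN fN by simp
  moreover have "(\<Sum>v\<in>?N. card {u \<in> ?N. E u v})
      = card {u \<in> ?N. E u (x m)} + (\<Sum>v\<in>?N - {x m}. card {u \<in> ?N. E u v})"
    using fN xmN by (rule sum.remove)
  moreover have "card (?N - {x m}) * c \<le> (\<Sum>v\<in>?N - {x m}. card {u \<in> ?N. E u v})"
    using sum_mono [of "?N - {x m}" "\<lambda>_. c" "\<lambda>v. card {u \<in> ?N. E u v}"] neighbourhood_in_degree [of 2]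
    by simp
  moreover have "card (?N - {x m}) = 2 * c" using cN xmN fN by simp
  moreover have "2 * (\<Sum>v\<in>?N. card {u \<in> ?N. E u v}) = (2 * c + 1) * (2 * c)"
    using sum_in_degree [of ?N] x_in_V cN by auto
  ultimately have "2 * (2 * c + 2 * c * c) \<le> (2 * c + 1) * (2 * c)" by simp
  then show False using c_pos by (simp add: algebra_simps)
qed

lemma contradiction: False
proof (cases "\<exists>w\<in>W. 2 \<le> cutoff w \<and> cutoff w + 2 \<le> m")
  case True
  then show False using middle_False by blast
next
  case False
  have "cutoff w \<le> 1 \<or> m \<le> cutoff w + 1" if "w \<in> W" for w
  proof -
    have "\<not> (2 \<le> cutoff w \<and> cutoff w + 2 \<le> m)" using False that by blast
    then show ?thesis by auto
  qed
  then show False by (rule extreme_False)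
qed

end

section \<open>Path extendability\<close>

lemma vwalk_arcs_iff_successively:
  "set (vwalk_arcs p) \<subseteq> arcs_ends G \<longleftrightarrow> successively (dominates G) p"
  by (induction p rule: vwalk_arcs.induct) auto

context tournament
begin

lemma tournament_relation_dominates: "tournament_relation (verts G) (dominates G)"
proof
  fix u v assume uv: "u \<rightarrow>\<^bsub>G\<^esub> v"
  then show "u \<in> verts G \<and> v \<in> verts G" using adj_in_verts by blast
  moreover have "u \<noteq> v" using uv adj_not_same by blast
  ultimately show "\<not> v \<rightarrow>\<^bsub>G\<^esub> u" using uv exactly_one_arc by blast
next
  show "u \<rightarrow>\<^bsub>G\<^esub> v \<or> v \<rightarrow>\<^bsub>G\<^esub> u" if "u \<in> verts G" "v \<in> verts G" "u \<noteq> v" for u v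
    using exactly_one_arc [OF that] by blast
qed simp

lemma card_out_neighbours: "card {u \<in> verts G. v \<rightarrow>\<^bsub>G\<^esub> u} = out_degree G v"
proof -
  have "{u \<in> verts G. v \<rightarrow>\<^bsub>G\<^esub> u} = head G ` out_arcs G v"
    by (auto simp: arcs_ends_conv)
  moreover have "inj_on (head G) (out_arcs G v)"
    by (rule inj_onI) (auto intro: no_multi_arcs simp: arc_to_ends_def)
  ultimately show ?thesis unfolding out_degree_def by (simp add: card_image)
qed

lemma card_in_neighbours: "card {u \<in> verts G. u \<rightarrow>\<^bsub>G\<^esub> v} = in_degree G v"
proof -
  have "{u \<in> verts G. u \<rightarrow>\<^bsub>G\<^esub> v} = tail G ` in_arcs G v"
    by (auto simp: arcs_ends_conv)
  moreover have "inj_on (tail G) (in_arcs G v)"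
    by (rule inj_onI) (auto intro: no_multi_arcs simp: arc_to_ends_def)
  ultimately show ?thesis unfolding in_degree_def by (simp add: card_image)
qed

lemma p2_eq:
  assumes "u \<in> verts G" "v \<in> verts G" "u \<noteq> v"
  shows "p2 G u v = card {y \<in> verts G. u \<rightarrow>\<^bsub>G\<^esub> y \<and> y \<rightarrow>\<^bsub>G\<^esub> v}"
proof -
  let ?Y = "{y \<in> verts G. u \<rightarrow>\<^bsub>G\<^esub> y \<and> y \<rightarrow>\<^bsub>G\<^esub> v}"
  have "{p. vpath p G \<and> vwalk_length p = 2 \<and> hd p = u \<and> last p = v} = (\<lambda>y. [u, y, v]) ` ?Y"
  proof (intro equalityI subsetI)
    fix p assume "p \<in> {p. vpath p G \<and> vwalk_length p = 2 \<and> hd p = u \<and> last p = v}"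
    then have p: "vpath p G" "length p = 3" "hd p = u" "last p = v" by auto
    then obtain y where "p = [u, y, v]"
      by (auto simp: numeral_3_eq_3 length_Suc_conv)
    then show "p \<in> (\<lambda>y. [u, y, v]) ` ?Y" using p(1) by (auto simp: vpath_def vwalk_def)
  next
    fix p assume "p \<in> (\<lambda>y. [u, y, v]) ` ?Y"
    then obtain y where y: "p = [u, y, v]" "y \<in> verts G" "u \<rightarrow>\<^bsub>G\<^esub> y" "y \<rightarrow>\<^bsub>G\<^esub> v" by auto
    then have "u \<noteq> y" "y \<noteq> v" using adj_not_same by blast+
    then show "p \<in> {p. vpath p G \<and> vwalk_length p = 2 \<and> hd p = u \<and> last p = v}"
      using y assms by (auto simp: vpath_def vwalk_def)
  qed
  then show ?thesis unfolding p2_def by (simp add: card_image inj_on_def)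
qed

lemma pi2_le_p2:
  assumes "u \<in> verts G" "v \<in> verts G" "u \<noteq> v"
  shows "pi2 G \<le> p2 G u v"
  unfolding pi2_def
proof (rule Min_le)
  have "{p2 G u v | u v. u \<in> verts G \<and> v \<in> verts G \<and> u \<noteq> v} \<subseteq> (\<lambda>(u, v). p2 G u v) ` (verts G \<times> verts G)"
    by auto
  then show "finite {p2 G u v | u v. u \<in> verts G \<and> v \<in> verts G \<and> u \<noteq> v}"
    by (rule finite_subset) simp
qed (use assms in blast)

lemma regular_degrees:
  assumes "regular_digraph G" "v \<in> verts G"
  shows "2 * card {u \<in> verts G. v \<rightarrow>\<^bsub>G\<^esub> u} + 1 = card (verts G)"
    and "2 * card {u \<in> verts G. u \<rightarrow>\<^bsub>G\<^esub> v} + 1 = card (verts G)"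
proof -
  interpret R: tournament_relation "verts G" "dominates G" by (rule tournament_relation_dominates)
  have "{u \<in> verts G. v \<rightarrow>\<^bsub>G\<^esub> u} \<union> {u \<in> verts G. u \<rightarrow>\<^bsub>G\<^esub> v} = verts G - {v}"
    using R.E_total [of v] assms(2) by auto
  moreover have "card ({u \<in> verts G. v \<rightarrow>\<^bsub>G\<^esub> u} \<union> {u \<in> verts G. u \<rightarrow>\<^bsub>G\<^esub> v})
      = card {u \<in> verts G. v \<rightarrow>\<^bsub>G\<^esub> u} + card {u \<in> verts G. u \<rightarrow>\<^bsub>G\<^esub> v}"
    using R.E_asym by (intro card_Un_disjoint) auto
  moreover have "card (verts G - {v}) + 1 = card (verts G)"
    using card_Suc_Diff1 [OF finite_verts assms(2)] by simp
  moreover have "card {u \<in> verts G. v \<rightarrow>\<^bsub>G\<^esub> u} = card {u \<in> verts G. u \<rightarrow>\<^bsub>G\<^esub> v}"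
    using assms unfolding card_out_neighbours card_in_neighbours regular_digraph_def by blast
  ultimately show "2 * card {u \<in> verts G. v \<rightarrow>\<^bsub>G\<^esub> u} + 1 = card (verts G)"
    "2 * card {u \<in> verts G. u \<rightarrow>\<^bsub>G\<^esub> v} + 1 = card (verts G)" by simp_all
qed

lemma stuck_path_nth:
  assumes p: "vpath p G" "1 \<le> vwalk_length p" "\<not> extendable_path G p"
  shows "stuck_path (verts G) (dominates G) (\<lambda>i. p ! (i - 1)) (length p)"
    and "(\<lambda>i. p ! (i - 1)) ` {0<..length p} = set p"
proof -
  interpret R: tournament_relation "verts G" "dominates G" by (rule tournament_relation_dominates)
  let ?x = "\<lambda>i. p ! (i - 1)"
  have d: "distinct p" and sub: "set p \<subseteq> verts G" and suc: "successively (dominates G) p" and ne: "p \<noteq> []"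
    using p(1) by (auto simp: vpath_def vwalk_def vwalk_arcs_iff_successively)
  show img: "?x ` {0<..length p} = set p"
  proof (intro equalityI subsetI)
    fix v assume "v \<in> set p"
    then obtain i where "i < length p" "v = p ! i" by (auto simp: in_set_conv_nth)
    then have "v = ?x (Suc i)" "Suc i \<in> {0<..length p}" by auto
    then show "v \<in> ?x ` {0<..length p}" by blast
  qed auto
  show "stuck_path (verts G) (dominates G) ?x (length p)"
  proof
    show "2 \<le> length p" using p(2) by simp
    show "inj_on ?x {0<..length p}"
      using d by (auto intro!: inj_onI simp: nth_eq_iff_index_eq)
    show "?x i \<rightarrow>\<^bsub>G\<^esub> ?x (Suc i)" if "0 < i" "i < length p" for i
      using suc that successively_nth [of "dominates G" p "i - 1"] by simp
    show False if q: "w \<in> verts G - ?x ` {0<..length p}" "distinct q" "successively (dominates G) q"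
      "set q = insert w (?x ` {0<..length p})" "hd q = ?x 1" "last q = ?x (length p)" for w q
    proof -
      have "vpath q G"
        using q(1,2,3) sub unfolding vpath_def vwalk_def vwalk_arcs_iff_successively q(4) [unfolded img]
        using q(4) by auto
      moreover have "hd q = hd p" "last q = last p"
        using q(5,6) ne by (simp_all add: hd_conv_nth last_conv_nth)
      ultimately have "extendable_path G p"
        unfolding extendable_path_def using q(1,4) unfolding img by blast
      then show False using p(3) by blast
    qed
  qed (use sub img in auto)
qed

end

theorem theorem6:
  fixes T :: "('a, 'b) pre_digraph" and n :: nat
  assumes "tournament T"
    and "regular_digraph T"
    and "card (verts T) = n"
    and "n \<ge> 9"
    and "real (pi2 T) > (real n - 9) / 12"
  shows "path_extendable T"
proof -
  interpret tournament T by fact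
  \<comment> \<open>For \<open>n >= 9\<close> the bound is nonnegative, so \<open>pi2 T\<close>
    exceeds 0.\<close>
  have pi_pos: "0 < pi2 T" using assms(4,5) by (cases "pi2 T") auto
  have n_less: "n < 12 * pi2 T + 9" using assms(5) by (simp add: field_simps)
  obtain v where "v \<in> verts T" using assms(3,4) by (cases "verts T = {}") auto
  then obtain k where k: "n = 2 * k + 1" using regular_degrees [OF assms(2)] assms(3) by metis
  have "extendable_path T p" if p: "vpath p T" "\<not> hamiltonian_path T p" "1 \<le> vwalk_length p" for p
  proof (rule ccontr)
    assume nx: "\<not> extendable_path T p"
    interpret stuck_path "verts T" "dominates T" "\<lambda>i. p ! (i - 1)" "length p"
      by (rule stuck_path_nth [OF p(1,3) nx])
    have img: "P = set p" by (rule stuck_path_nth [OF p(1,3) nx])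
    interpret regular_stuck_path "verts T" "dominates T" "\<lambda>i. p ! (i - 1)" "length p" k "pi2 T"
    proof
      show "W \<noteq> {}" using p(1,2) x_in_V unfolding img hamiltonian_path_def by blast
      show "pi2 T \<le> card {y \<in> verts T. u \<rightarrow>\<^bsub>T\<^esub> y \<and> y \<rightarrow>\<^bsub>T\<^esub> v}"
        if "u \<in> verts T" "v \<in> verts T" "u \<noteq> v" for u v
        using pi2_le_p2 [OF that] unfolding p2_eq [OF that] .
      show "card {u \<in> verts T. v \<rightarrow>\<^bsub>T\<^esub> u} = k" "card {u \<in> verts T. u \<rightarrow>\<^bsub>T\<^esub> v} = k"
        if "v \<in> verts T" for v
        using regular_degrees [OF assms(2) that] assms(3) k by simp_all
    qed (use assms(3) k pi_pos n_less in simp_all)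
    show False by (rule contradiction)
  qed
  then show ?thesis unfolding path_extendable_def by blast
qed

end
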